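(* Let $I\subset\mathbb{R}$ be an interval and let $\gamma:I\to\mathbb{R}^3$ be a non-degenerate curve with curvature $\kappa$ and torsion $\tau$. (1) Suppose that $\tau(t)\neq 0$ for all $t\in I$ and that there exists a smooth function $h:I\to\mathbb{R}$ such that $$h(t)=\frac{|\dot\gamma(t)|\tau(t)}{\kappa(t)}-\frac{d}{dt}\left(\frac{\dot\kappa(t)}{\kappa^2(t)}\,\frac{1}{|\dot\gamma(t)|\tau(t)}\right)\neq 0$$ for all $t\in I$. Then $\gamma$ is an $(n,b,\overline{b})$-Bertrand type curve if and only if there exists a smooth map $(\lambda,\eta):I\to\mathbb{R}^2$ with $(\lambda,\eta)\not\equiv(0,0)$ such that $\lambda(t)=1/\kappa(t)$ and $\eta(t)=-\dot\kappa(t)/(|\dot\gamma(t)|\kappa^2(t)\tau(t))$ for all $t\in I$. (2) Suppose that there exists a point $t\in I$ such that $\tau(t)=0$. Then $\gamma$ is not an $(n,b,\overline{b})$-Bertrand type curve.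
   Context: All maps are $C^\infty$. A smooth curve $\gamma:I\to\mathbb{R}^3$ is non-degenerate if it is regular ($\dot\gamma(t)\neq0$ for all $t$) and $\dot\gamma(t)\times\ddot\gamma(t)\neq 0$ for all $t\in I$. For such a curve, the tangent, bi-normal and principal normal vectors are $t=\dot\gamma/|\dot\gamma|$, $b=(\dot\gamma\times\ddot\gamma)/|\dot\gamma\times\ddot\gamma|$, $n=b\times t$, the curvature is $\kappa=|\dot\gamma\times\ddot\gamma|/|\dot\gamma|^3$ and the torsion is $\tau=\det(\dot\gamma,\ddot\gamma,\dddot\gamma)/|\dot\gamma\times\ddot\gamma|^2$ (the letter $t$ also denotes the parameter). For a second non-degenerate curve $\overline\gamma$, barred symbols $\overline t,\overline n,\overline b$ denote its frame vectors. For $v,w,x\in\{t,n,b\}$, non-degenerate curves $\gamma,\overline\gamma:I\to\mathbb{R}^3$ are $(v,w,\overline x)$-mates if there exists a smooth map $(\lambda,\eta):I\to\mathbb{R}^2$ with $(\lambda,\eta)\not\equiv(0,0)$ such that $\overline\gamma(t)=\gamma(t)+\lambda(t)v(t)+\eta(t)w(t)$ and $v(t)\times w(t)=\pm\overline x(t)$ for all $t\in I$. The curve $\gamma$ is a $(v,w,\overline x)$-Bertrand type curve if there exists another non-degenerate curve $\overline\gamma$ such that $\gamma$ and $\overline\gamma$ are $(v,w,\overline x)$-mates. Here $(\lambda,\eta)\not\equiv(0,0)$ means that $(\lambda,\eta)$ is not identically zero on any non-trivial subinterval of $I$. *)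

theory Defs
  imports "HOL-Analysis.Analysis"
begin

text \<open>Derivatives are taken within the interval, so they are one-sided at an endpoint
  belonging to it.\<close>

definition deriv_within :: "real set \<Rightarrow> (real \<Rightarrow> 'a::real_normed_vector) \<Rightarrow> real \<Rightarrow> 'a" where
  "deriv_within I f t = vector_derivative f (at t within I)"

definition smooth_on :: "real set \<Rightarrow> (real \<Rightarrow> 'a::real_normed_vector) \<Rightarrow> bool" where
  "smooth_on I f \<longleftrightarrow> (\<forall>k. (deriv_within I ^^ k) f differentiable_on I)"

definition nontrivial_interval :: "real set \<Rightarrow> bool" where
  "nontrivial_interval I \<longleftrightarrow> is_interval I \<and> (\<exists>a\<in>I. \<exists>b\<in>I. a < b)"

definition speed :: "real set \<Rightarrow> (real \<Rightarrow> real^3) \<Rightarrow> real \<Rightarrow> real" where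
  "speed I \<gamma> t = norm (deriv_within I \<gamma> t)"

definition velocity_cross_acceleration :: "real set \<Rightarrow> (real \<Rightarrow> real^3) \<Rightarrow> real \<Rightarrow> real^3" where
  "velocity_cross_acceleration I \<gamma> t =
     cross3 (deriv_within I \<gamma> t) ((deriv_within I ^^ 2) \<gamma> t)"

definition nondegenerate_curve :: "real set \<Rightarrow> (real \<Rightarrow> real^3) \<Rightarrow> bool" where
  "nondegenerate_curve I \<gamma> \<longleftrightarrow> smooth_on I \<gamma> \<and>
     (\<forall>t\<in>I. deriv_within I \<gamma> t \<noteq> 0 \<and> velocity_cross_acceleration I \<gamma> t \<noteq> 0)"

definition tangent :: "real set \<Rightarrow> (real \<Rightarrow> real^3) \<Rightarrow> real \<Rightarrow> real^3" where
  "tangent I \<gamma> t = deriv_within I \<gamma> t /\<^sub>R speed I \<gamma> t"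

definition binormal :: "real set \<Rightarrow> (real \<Rightarrow> real^3) \<Rightarrow> real \<Rightarrow> real^3" where
  "binormal I \<gamma> t =
     velocity_cross_acceleration I \<gamma> t /\<^sub>R norm (velocity_cross_acceleration I \<gamma> t)"

definition principal_normal :: "real set \<Rightarrow> (real \<Rightarrow> real^3) \<Rightarrow> real \<Rightarrow> real^3" where
  "principal_normal I \<gamma> t = cross3 (binormal I \<gamma> t) (tangent I \<gamma> t)"

definition curvature :: "real set \<Rightarrow> (real \<Rightarrow> real^3) \<Rightarrow> real \<Rightarrow> real" where
  "curvature I \<gamma> t = norm (velocity_cross_acceleration I \<gamma> t) / speed I \<gamma> t ^ 3"

definition torsion :: "real set \<Rightarrow> (real \<Rightarrow> real^3) \<Rightarrow> real \<Rightarrow> real" where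
  "torsion I \<gamma> t =
     det (vector [deriv_within I \<gamma> t, (deriv_within I ^^ 2) \<gamma> t, (deriv_within I ^^ 3) \<gamma> t]
            :: real^3^3)
     / (norm (velocity_cross_acceleration I \<gamma> t))\<^sup>2"

datatype frame_symbol = Tangent | Normal | Binormal

fun frame :: "real set \<Rightarrow> (real \<Rightarrow> real^3) \<Rightarrow> frame_symbol \<Rightarrow> real \<Rightarrow> real^3" where
  "frame I \<gamma> Tangent = tangent I \<gamma>"
| "frame I \<gamma> Normal = principal_normal I \<gamma>"
| "frame I \<gamma> Binormal = binormal I \<gamma>"

text \<open>The convention for \<open>(\<lambda>, \<eta>) \<not>\<equiv> (0, 0)\<close>: not identically zero on any non-trivial
  subinterval, which is stronger than not being the zero map.\<close>

definition nowhere_identically_zero :: "real set \<Rightarrow> (real \<Rightarrow> 'a::zero) \<Rightarrow> bool" where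
  "nowhere_identically_zero I f \<longleftrightarrow>
     (\<forall>J. nontrivial_interval J \<and> J \<subseteq> I \<longrightarrow> (\<exists>t\<in>J. f t \<noteq> 0))"

definition mates ::
  "real set \<Rightarrow> frame_symbol \<Rightarrow> frame_symbol \<Rightarrow> frame_symbol \<Rightarrow>
   (real \<Rightarrow> real^3) \<Rightarrow> (real \<Rightarrow> real^3) \<Rightarrow> bool" where
  "mates I v w x \<gamma> \<gamma>' \<longleftrightarrow>
     nondegenerate_curve I \<gamma> \<and> nondegenerate_curve I \<gamma>' \<and>
     (\<exists>l e :: real \<Rightarrow> real.
        smooth_on I (\<lambda>t. (l t, e t)) \<and> nowhere_identically_zero I (\<lambda>t. (l t, e t)) \<and>
        (\<forall>t\<in>I. \<gamma>' t = \<gamma> t + l t *\<^sub>R frame I \<gamma> v t + e t *\<^sub>R frame I \<gamma> w t \<and>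
           (cross3 (frame I \<gamma> v t) (frame I \<gamma> w t) = frame I \<gamma>' x t \<or>
            cross3 (frame I \<gamma> v t) (frame I \<gamma> w t) = - frame I \<gamma>' x t)))"

definition bertrand_type ::
  "real set \<Rightarrow> frame_symbol \<Rightarrow> frame_symbol \<Rightarrow> frame_symbol \<Rightarrow> (real \<Rightarrow> real^3) \<Rightarrow> bool" where
  "bertrand_type I v w x \<gamma> \<longleftrightarrow>
     (\<exists>\<gamma>'. nondegenerate_curve I \<gamma>' \<and> (\<exists>t\<in>I. \<gamma>' t \<noteq> \<gamma> t) \<and> mates I v w x \<gamma> \<gamma>')"

end

theory Submission
  imports Defs
begin

text \<open>
  Write \<open>\<sigma>\<close> for the speed and \<open>T, N, B\<close> for the Frenet frame of \<open>\<gamma>\<close>. Since \<open>N \<times> B = T\<close>, a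
  mate in question is a curve \<open>\<delta> = \<gamma> + l N + e B\<close> whose binormal is \<open>\<plusminus>T\<close>, and the Frenet equations give
  \<open>\<delta>' = \<sigma> (1 - l \<kappa>) T + (l' - e \<sigma> \<tau>) N + (e' + l \<sigma> \<tau>) B\<close> (\<open>deriv_within_displaced_curve\<close>).

  Having binormal \<open>\<plusminus>T\<close> means that \<open>\<delta>'\<close> and \<open>\<delta>''\<close> are orthogonal to \<open>T\<close>. The first condition says
  \<open>l = 1 / \<kappa>\<close>. The second, in the presence of the first, says that \<open>\<delta>'\<close> has no component along
  \<open>T' = \<sigma> \<kappa> N\<close>, that is \<open>l' = e \<sigma> \<tau>\<close> (\<open>normal_binormal_mateE\<close>). Where \<open>\<tau> \<noteq> 0\<close> this determines
  \<open>e = - \<kappa>' / (\<sigma> \<kappa>\<^sup>2 \<tau>)\<close>.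

  What remains is \<open>\<delta>' = u B\<close> with \<open>u = e' + l \<sigma> \<tau>\<close>, and then \<open>\<delta>' \<times> \<delta>'' = u\<^sup>2 \<sigma> \<tau> T\<close>
  (\<open>cross_along_binormal\<close>). At a zero of \<open>\<tau>\<close> this vanishes, so no non-degenerate mate exists
  (\<open>torsion_nonzero_of_mate\<close>). Conversely, for the above \<open>l\<close> and \<open>e\<close> the function \<open>u\<close> is precisely
  the \<open>h\<close> of the theorem; as \<open>h\<close> and \<open>\<tau>\<close> have no zeros, the displaced curve is non-degenerate with
  binormal \<open>\<plusminus>T\<close> (\<open>bertrand_type_of_displacement\<close>).

  The hypotheses concern one-sided derivatives at the endpoints of \<open>I\<close>, so the calculus of
  smooth maps is developed for derivatives within the interval; it supplies the smoothness of the
  frame, the curvature and the torsion.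
\<close>

section \<open>Smooth maps on an interval\<close>

lemma at_within_nontrivial_interval:
  assumes "nontrivial_interval I" "t \<in> I"
  shows "at t within I \<noteq> bot"
proof -
  obtain a b where ab: "a \<in> I" "b \<in> I" "a < b"
    using assms(1) unfolding nontrivial_interval_def by blast
  have "connected I"
    using assms(1) is_interval_connected unfolding nontrivial_interval_def by blast
  moreover have "I \<noteq> {t}"
    using ab by auto
  ultimately have "t islimpt I"
    using connected_imp_perfect[of I t] assms(2) by auto
  then show ?thesis
    using trivial_limit_within by metis
qed

lemma deriv_within_eqI:
  assumes "nontrivial_interval I" "t \<in> I" "(f has_vector_derivative d) (at t within I)"
  shows "deriv_within I f t = d"
  unfolding deriv_within_def
  using vector_derivative_within[OF at_within_nontrivial_interval[OF assms(1,2)] assms(3)] .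

lemma deriv_within_works:
  assumes "f differentiable_on I" "t \<in> I"
  shows "(f has_vector_derivative deriv_within I f t) (at t within I)"
  using assms unfolding deriv_within_def differentiable_on_def
  by (simp add: vector_derivative_works)

lemma deriv_within_cong:
  assumes "nontrivial_interval I" "f differentiable_on I" "\<And>s. s \<in> I \<Longrightarrow> f s = g s" "t \<in> I"
  shows "deriv_within I g t = deriv_within I f t"
  by (rule deriv_within_eqI[OF assms(1,4)],
      rule has_vector_derivative_transform[OF assms(4) _ deriv_within_works[OF assms(2,4)]])
     (simp add: assms(3))

text \<open>Smoothness quantifies over all iterated derivatives, whereas the derivative of a product
  involves the factors themselves as well as their derivatives. Counting orders makes closure
  under the usual operations provable by induction: only one derivative is taken per step.\<close>

primrec times_differentiable_on :: "nat \<Rightarrow> real set \<Rightarrow> (real \<Rightarrow> 'a::real_normed_vector) \<Rightarrow> bool"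
  where
    "times_differentiable_on 0 I f \<longleftrightarrow> True"
  | "times_differentiable_on (Suc k) I f \<longleftrightarrow>
       f differentiable_on I \<and> times_differentiable_on k I (deriv_within I f)"

lemma times_differentiable_on_iff:
  "times_differentiable_on k I f \<longleftrightarrow> (\<forall>j<k. (deriv_within I ^^ j) f differentiable_on I)"
  by (induction k arbitrary: f) (auto simp: less_Suc_eq_0_disj funpow_swap1)

lemma smooth_on_iff: "smooth_on I f \<longleftrightarrow> (\<forall>k. times_differentiable_on k I f)"
  unfolding smooth_on_def times_differentiable_on_iff by blast

lemma smooth_on_differentiable_on: "smooth_on I f \<Longrightarrow> f differentiable_on I"
  unfolding smooth_on_def by (metis funpow_0)

lemma smooth_on_deriv_within: "smooth_on I f \<Longrightarrow> smooth_on I (deriv_within I f)"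
  unfolding smooth_on_iff by (metis times_differentiable_on.simps(2))

lemma smooth_on_has_vector_derivative:
  "smooth_on I f \<Longrightarrow> t \<in> I \<Longrightarrow> (f has_vector_derivative deriv_within I f t) (at t within I)"
  using deriv_within_works smooth_on_differentiable_on by blast

lemma times_differentiable_on_lower:
  "times_differentiable_on (Suc k) I f \<Longrightarrow> times_differentiable_on k I f"
  by (induction k arbitrary: f) auto

lemma times_differentiable_on_cong:
  assumes "nontrivial_interval I" "times_differentiable_on k I f" "\<And>s. s \<in> I \<Longrightarrow> f s = g s"
  shows "times_differentiable_on k I g"
  using assms(2,3)
proof (induction k arbitrary: f g)
  case (Suc k)
  have "f differentiable_on I"
    using Suc.prems by simp
  then have "g differentiable_on I"
    using Suc.prems(2) unfolding differentiable_on_def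
    by (metis differentiable_transform_within zero_less_one)
  moreover have "times_differentiable_on k I (deriv_within I g)"
    by (rule Suc.IH[of "deriv_within I f"])
       (use Suc.prems deriv_within_cong[OF assms(1) _ Suc.prems(2)] in simp_all)
  ultimately show ?case
    by simp
qed simp

lemma times_differentiable_on_SucI:
  assumes "nontrivial_interval I"
    and "\<And>t. t \<in> I \<Longrightarrow> (f has_vector_derivative f' t) (at t within I)"
    and "times_differentiable_on k I f'"
  shows "times_differentiable_on (Suc k) I f"
proof -
  have "f differentiable_on I"
    unfolding differentiable_on_def using assms(2) differentiableI_vector by blast
  moreover have "times_differentiable_on k I (deriv_within I f)"
    by (rule times_differentiable_on_cong[OF assms(1,3)])
       (simp add: deriv_within_eqI[OF assms(1) _ assms(2)])
  ultimately show ?thesis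
    by simp
qed

lemma times_differentiable_on_add:
  assumes "nontrivial_interval I" "times_differentiable_on k I f" "times_differentiable_on k I g"
  shows "times_differentiable_on k I (\<lambda>t. f t + g t)"
  using assms(2,3)
proof (induction k arbitrary: f g)
  case (Suc k)
  show ?case
    by (rule times_differentiable_on_SucI[OF assms(1)
          has_vector_derivative_add[OF deriv_within_works deriv_within_works]])
       (use Suc in auto)
qed simp

lemma (in bounded_linear) times_differentiable_on:
  assumes "nontrivial_interval I" "times_differentiable_on k I g"
  shows "times_differentiable_on k I (\<lambda>t. f (g t))"
  using assms(2)
proof (induction k arbitrary: g)
  case (Suc k)
  show ?case
    by (rule times_differentiable_on_SucI[OF assms(1) has_vector_derivative[OF deriv_within_works]])
       (use Suc in auto)
qed simp

lemma (in bounded_bilinear) times_differentiable_on: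
  assumes "nontrivial_interval I" "times_differentiable_on k I f" "times_differentiable_on k I g"
  shows "times_differentiable_on k I (\<lambda>t. prod (f t) (g t))"
  using assms(2,3)
proof (induction k arbitrary: f g)
  case (Suc k)
  have "times_differentiable_on k I
      (\<lambda>t. prod (f t) (deriv_within I g t) + prod (deriv_within I f t) (g t))"
    using Suc.prems times_differentiable_on_lower[of k I f] times_differentiable_on_lower[of k I g]
    by (intro times_differentiable_on_add[OF assms(1)] Suc.IH) auto
  then show ?case
    by (rule times_differentiable_on_SucI[OF assms(1)
          has_vector_derivative[OF deriv_within_works deriv_within_works], rotated -1])
       (use Suc in auto)
qed simp

lemma smooth_on_add:
  assumes "nontrivial_interval I" "smooth_on I f" "smooth_on I g"
  shows "smooth_on I (\<lambda>t. f t + g t)"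
  using assms times_differentiable_on_add[OF assms(1)] unfolding smooth_on_iff by blast

lemma (in bounded_linear) smooth_on:
  assumes "nontrivial_interval I" "smooth_on I g"
  shows "smooth_on I (\<lambda>t. f (g t))"
  using assms times_differentiable_on[OF assms(1)] unfolding smooth_on_iff by blast

lemma (in bounded_bilinear) smooth_on:
  assumes "nontrivial_interval I" "smooth_on I f" "smooth_on I g"
  shows "smooth_on I (\<lambda>t. prod (f t) (g t))"
  using assms times_differentiable_on[OF assms(1)] unfolding smooth_on_iff by blast

lemmas smooth_on_mult = bounded_bilinear.smooth_on[OF bounded_bilinear_mult]
lemmas smooth_on_scaleR = bounded_bilinear.smooth_on[OF bounded_bilinear_scaleR]
lemmas smooth_on_inner = bounded_bilinear.smooth_on[OF bounded_bilinear_inner]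

lemma bounded_bilinear_cross3: "bounded_bilinear cross3"
  using bilinear_cross bilinear_conv_bounded_bilinear by blast

lemmas smooth_on_cross3 = bounded_bilinear.smooth_on[OF bounded_bilinear_cross3]

text \<open>Reciprocal and square root solve first-order equations, \<open>g' = - g\<^sup>2\<close> and \<open>g' x = g x / (2 x)\<close>.
  Hence \<open>g' \<circ> f\<close> is as often differentiable as \<open>g \<circ> f\<close>, and each order of differentiability of
  \<open>g \<circ> f\<close> yields the next.\<close>

lemma smooth_on_compose_ode:
  fixes f :: "real \<Rightarrow> real"
  assumes I: "nontrivial_interval I" and f: "smooth_on I f"
    and g: "\<And>t. t \<in> I \<Longrightarrow> (g has_real_derivative g' (f t)) (at (f t))"
    and ode: "\<And>k. times_differentiable_on k I (\<lambda>t. g (f t)) \<Longrightarrow>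
                times_differentiable_on k I (\<lambda>t. g' (f t))"
  shows "smooth_on I (\<lambda>t. g (f t))"
  unfolding smooth_on_iff
proof
  fix k
  show "times_differentiable_on k I (\<lambda>t. g (f t))"
  proof (induction k)
    case (Suc k)
    have "times_differentiable_on k I (\<lambda>t. deriv_within I f t * g' (f t))"
      using smooth_on_deriv_within[OF f] ode[OF Suc]
      by (intro bounded_bilinear.times_differentiable_on[OF bounded_bilinear_mult I])
         (auto simp: smooth_on_iff)
    moreover have "((\<lambda>t. g (f t)) has_vector_derivative deriv_within I f t * g' (f t))
        (at t within I)" if "t \<in> I" for t
      using DERIV_chain2[where f = g and g = f, OF g[OF that]]
        smooth_on_has_vector_derivative[OF f that]
      unfolding has_real_derivative_iff_has_vector_derivative[symmetric]
      by (metis mult.commute)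
    ultimately show ?case
      by (rule times_differentiable_on_SucI[OF I, rotated])
  qed simp
qed

lemma smooth_on_inverse:
  fixes f :: "real \<Rightarrow> real"
  assumes I: "nontrivial_interval I" and f: "smooth_on I f" and nz: "\<And>t. t \<in> I \<Longrightarrow> f t \<noteq> 0"
  shows "smooth_on I (\<lambda>t. inverse (f t))"
proof (rule smooth_on_compose_ode[OF I f, where g' = "\<lambda>x. - (inverse x * inverse x)"])
  fix t assume "t \<in> I"
  then show "(inverse has_real_derivative - (inverse (f t) * inverse (f t))) (at (f t))"
    using DERIV_inverse[of "f t"] nz by (simp add: power2_eq_square)
next
  fix k assume "times_differentiable_on k I (\<lambda>t. inverse (f t))"
  then show "times_differentiable_on k I (\<lambda>t. - (inverse (f t) * inverse (f t)))"
    by (intro bounded_linear.times_differentiable_on[OF bounded_linear_minus[OF bounded_linear_ident] I]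
        bounded_bilinear.times_differentiable_on[OF bounded_bilinear_mult I])
qed

lemma smooth_on_divide:
  fixes f g :: "real \<Rightarrow> real"
  assumes "nontrivial_interval I" "smooth_on I f" "smooth_on I g" "\<And>t. t \<in> I \<Longrightarrow> g t \<noteq> 0"
  shows "smooth_on I (\<lambda>t. f t / g t)"
  unfolding divide_inverse using assms by (intro smooth_on_mult smooth_on_inverse)

lemma smooth_on_sqrt:
  fixes f :: "real \<Rightarrow> real"
  assumes I: "nontrivial_interval I" and f: "smooth_on I f" and pos: "\<And>t. t \<in> I \<Longrightarrow> f t > 0"
  shows "smooth_on I (\<lambda>t. sqrt (f t))"
proof (rule smooth_on_compose_ode[OF I f, where g' = "\<lambda>x. sqrt x * (inverse x / 2)"])
  fix t assume "t \<in> I"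
  then have "inverse (sqrt (f t)) / 2 = sqrt (f t) * (inverse (f t) / 2)"
    using pos[of t] real_sqrt_mult_self[of "f t"] by (simp add: field_simps)
  then show "(sqrt has_real_derivative sqrt (f t) * (inverse (f t) / 2)) (at (f t))"
    using DERIV_real_sqrt[of "f t"] pos[of t] \<open>t \<in> I\<close> by simp
next
  fix k assume "times_differentiable_on k I (\<lambda>t. sqrt (f t))"
  moreover have "smooth_on I (\<lambda>t. inverse (f t))"
    using smooth_on_inverse[OF I f] pos by fastforce
  ultimately show "times_differentiable_on k I (\<lambda>t. sqrt (f t) * (inverse (f t) / 2))"
    by (intro bounded_bilinear.times_differentiable_on[OF bounded_bilinear_mult I]
        bounded_linear.times_differentiable_on[OF bounded_linear_divide[of 2] I])
       (auto simp: smooth_on_iff)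
qed

lemma smooth_on_norm:
  fixes f :: "real \<Rightarrow> 'a::real_inner"
  assumes "nontrivial_interval I" "smooth_on I f" "\<And>t. t \<in> I \<Longrightarrow> f t \<noteq> 0"
  shows "smooth_on I (\<lambda>t. norm (f t))"
  unfolding norm_eq_sqrt_inner using assms
  by (intro smooth_on_sqrt smooth_on_inner) auto

lemma smooth_on_normalize:
  fixes f :: "real \<Rightarrow> 'a::real_inner"
  assumes "nontrivial_interval I" "smooth_on I f" "\<And>t. t \<in> I \<Longrightarrow> f t \<noteq> 0"
  shows "smooth_on I (\<lambda>t. f t /\<^sub>R norm (f t))"
  using assms by (intro smooth_on_scaleR smooth_on_inverse smooth_on_norm) auto

lemma deriv_within_add:
  assumes "nontrivial_interval I" "smooth_on I f" "smooth_on I g" "t \<in> I"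
  shows "deriv_within I (\<lambda>s. f s + g s) t = deriv_within I f t + deriv_within I g t"
  using assms by (intro deriv_within_eqI has_vector_derivative_add smooth_on_has_vector_derivative)

lemma (in bounded_bilinear) deriv_within:
  assumes "nontrivial_interval I" "smooth_on I f" "smooth_on I g" "t \<in> I"
  shows "deriv_within I (\<lambda>s. prod (f s) (g s)) t =
           prod (f t) (deriv_within I g t) + prod (deriv_within I f t) (g t)"
  using assms by (intro deriv_within_eqI has_vector_derivative smooth_on_has_vector_derivative)

lemmas deriv_within_scaleR = bounded_bilinear.deriv_within[OF bounded_bilinear_scaleR]
lemmas deriv_within_inner = bounded_bilinear.deriv_within[OF bounded_bilinear_inner]
lemmas deriv_within_cross3 = bounded_bilinear.deriv_within[OF bounded_bilinear_cross3]

lemma inner_deriv_within_eq_0: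
  assumes "nontrivial_interval I" "smooth_on I f" "smooth_on I g" "t \<in> I"
    and const: "\<And>s. s \<in> I \<Longrightarrow> f s \<bullet> g s = c"
  shows "f t \<bullet> deriv_within I g t + deriv_within I f t \<bullet> g t = 0"
proof -
  have "((\<lambda>s. f s \<bullet> g s) has_vector_derivative 0) (at t within I)"
    by (rule has_vector_derivative_transform[OF assms(4) _ has_vector_derivative_const[of c]])
       (simp add: const)
  then show ?thesis
    using deriv_within_eqI[OF assms(1,4)] deriv_within_inner[OF assms(1-4)] by metis
qed

section \<open>Orthonormal frames in space\<close>

lemma orthonormal_frame_cross3:
  fixes t b :: "real^3"
  assumes "t \<bullet> t = 1" "b \<bullet> b = 1" "t \<bullet> b = 0"
  defines "n \<equiv> cross3 b t"
  shows "n \<bullet> n = 1" "n \<bullet> t = 0" "n \<bullet> b = 0" "cross3 t n = b" "cross3 n b = t"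
proof -
  show "n \<bullet> t = 0" "n \<bullet> b = 0"
    unfolding n_def by (simp_all add: dot_cross_self)
  show "cross3 t n = b" "cross3 n b = t"
    unfolding n_def using assms(1-3) cross_skew[of "cross3 b t" b]
    by (simp_all add: Lagrange inner_commute)
  have "(norm n)\<^sup>2 = 1"
    using norm_cross_dot[of b t] assms(1-3) unfolding n_def
    by (simp add: norm_eq_1[symmetric] inner_commute)
  then show "n \<bullet> n = 1"
    by (simp add: power2_norm_eq_inner)
qed

lemma orthonormal_frame_expansion:
  fixes t b v :: "real^3"
  assumes "t \<bullet> t = 1" "b \<bullet> b = 1" "t \<bullet> b = 0"
  defines "n \<equiv> cross3 b t"
  shows "v = (v \<bullet> t) *\<^sub>R t + (v \<bullet> n) *\<^sub>R n + (v \<bullet> b) *\<^sub>R b"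
proof -
  note frame = orthonormal_frame_cross3[OF assms(1-3), folded n_def]
  define w where "w = v - ((v \<bullet> t) *\<^sub>R t + (v \<bullet> n) *\<^sub>R n + (v \<bullet> b) *\<^sub>R b)"
  have w: "w \<bullet> t = 0" "w \<bullet> n = 0" "w \<bullet> b = 0"
    unfolding w_def using assms(1-3) frame(1-3)
    by (simp_all add: inner_diff_left inner_diff_right inner_add_left inner_add_right inner_commute)
  have "cross3 w n = 0"
    unfolding n_def Lagrange using w by simp
  with w frame(1) have "w = 0"
    using norm_and_cross_eq_0[of w n] by auto
  then show ?thesis
    unfolding w_def by simp
qed

section \<open>The Frenet equations\<close>

locale nondegenerate_space_curve =
  fixes I :: "real set" and \<gamma> :: "real \<Rightarrow> real^3"
  assumes interval: "nontrivial_interval I"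
    and nondegenerate: "nondegenerate_curve I \<gamma>"
begin

abbreviation "\<sigma> \<equiv> speed I \<gamma>"
abbreviation "\<kappa> \<equiv> curvature I \<gamma>"
abbreviation "\<tau> \<equiv> torsion I \<gamma>"
abbreviation "T \<equiv> tangent I \<gamma>"
abbreviation "N \<equiv> principal_normal I \<gamma>"
abbreviation "B \<equiv> binormal I \<gamma>"
abbreviation "vel \<equiv> deriv_within I \<gamma>"
abbreviation "acc \<equiv> deriv_within I vel"
abbreviation "V \<equiv> velocity_cross_acceleration I \<gamma>"

lemma V_eq: "V t = cross3 (vel t) (acc t)"
  unfolding velocity_cross_acceleration_def by (simp add: numeral_2_eq_2)

lemma smooth_curve: "smooth_on I \<gamma>" "smooth_on I vel" "smooth_on I acc"
  using nondegenerate smooth_on_deriv_within unfolding nondegenerate_curve_def by blast+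

lemma vel_nz: "t \<in> I \<Longrightarrow> vel t \<noteq> 0" and V_nz: "t \<in> I \<Longrightarrow> V t \<noteq> 0"
  using nondegenerate unfolding nondegenerate_curve_def by blast+

lemma smooth_V: "smooth_on I V"
  unfolding V_eq[abs_def] by (intro smooth_on_cross3 interval smooth_curve)

lemma speed_pos: "t \<in> I \<Longrightarrow> \<sigma> t > 0"
  unfolding speed_def using vel_nz by simp

lemma curvature_pos: "t \<in> I \<Longrightarrow> \<kappa> t > 0"
  unfolding curvature_def using V_nz speed_pos by simp

lemma smooth_speed: "smooth_on I \<sigma>"
  unfolding speed_def[abs_def] by (intro smooth_on_norm interval smooth_curve vel_nz)

lemma smooth_norm_V: "smooth_on I (\<lambda>t. norm (V t))"
  by (intro smooth_on_norm interval smooth_V V_nz)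

lemma smooth_curvature: "smooth_on I \<kappa>"
  unfolding curvature_def[abs_def] power3_eq_cube
  by (intro smooth_on_divide smooth_on_mult interval smooth_norm_V smooth_speed)
    (use speed_pos in fastforce)

lemma torsion_eq: "\<tau> t = (V t \<bullet> deriv_within I acc t) / (norm (V t))\<^sup>2"
proof -
  have "det (vector [vel t, acc t, deriv_within I acc t] :: real^3^3)
      = cross3 (vel t) (acc t) \<bullet> deriv_within I acc t"
    by (simp add: dot_cross_det[symmetric]) (simp add: cross3_simps)
  then show ?thesis
    unfolding torsion_def V_eq by (simp add: numeral_2_eq_2 numeral_3_eq_3)
qed

lemma smooth_torsion: "smooth_on I \<tau>"
  unfolding torsion_eq[abs_def] power2_eq_square
  by (intro smooth_on_divide smooth_on_inner smooth_on_mult smooth_norm_V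
      smooth_on_deriv_within smooth_curve smooth_V interval)
    (use V_nz in auto)

lemma smooth_frame: "smooth_on I T" "smooth_on I N" "smooth_on I B"
proof -
  show T: "smooth_on I T"
    unfolding tangent_def[abs_def] speed_def
    by (intro smooth_on_normalize interval smooth_curve vel_nz)
  show B: "smooth_on I B"
    unfolding binormal_def[abs_def]
    by (intro smooth_on_normalize interval smooth_V V_nz)
  show "smooth_on I N"
    unfolding principal_normal_def[abs_def] by (intro smooth_on_cross3 interval T B)
qed

lemma vel_eq: "t \<in> I \<Longrightarrow> vel t = \<sigma> t *\<^sub>R T t"
  unfolding tangent_def using speed_pos by fastforce

lemma V_eq_binormal: "t \<in> I \<Longrightarrow> V t = norm (V t) *\<^sub>R B t"
  unfolding binormal_def using V_nz by simp

lemma frame_tangent_binormal: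
  assumes "t \<in> I"
  shows "T t \<bullet> T t = 1" "B t \<bullet> B t = 1" "T t \<bullet> B t = 0"
proof -
  have "norm (T t) = 1" "norm (B t) = 1"
    unfolding tangent_def binormal_def speed_def using vel_nz V_nz assms by simp_all
  then show "T t \<bullet> T t = 1" "B t \<bullet> B t = 1"
    by (simp_all add: norm_eq_1)
  show "T t \<bullet> B t = 0"
    unfolding tangent_def binormal_def V_eq by (simp add: dot_cross_self)
qed

lemma frame_normal:
  assumes "t \<in> I"
  shows "N t \<bullet> N t = 1" "N t \<bullet> T t = 0" "N t \<bullet> B t = 0"
    and "cross3 (T t) (N t) = B t" "cross3 (N t) (B t) = T t"
  using orthonormal_frame_cross3[OF frame_tangent_binormal[OF assms]]
  unfolding principal_normal_def by blast+

lemma frame_expansion: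
  assumes "t \<in> I"
  shows "v = (v \<bullet> T t) *\<^sub>R T t + (v \<bullet> N t) *\<^sub>R N t + (v \<bullet> B t) *\<^sub>R B t"
  using orthonormal_frame_expansion[OF frame_tangent_binormal[OF assms]]
  unfolding principal_normal_def by blast

lemma acc_normal_binormal:
  assumes "t \<in> I"
  shows "acc t \<bullet> N t = (\<sigma> t)\<^sup>2 * \<kappa> t" "acc t \<bullet> B t = 0"
proof -
  have "acc t \<bullet> cross3 (V t) (vel t) = (norm (V t))\<^sup>2"
    unfolding power2_norm_eq_inner by (simp add: V_eq) (simp add: cross3_simps)
  then have "acc t \<bullet> N t = (norm (V t))\<^sup>2 / (norm (V t) * \<sigma> t)"
    unfolding principal_normal_def tangent_def binormal_def
    by (simp add: cross_mult_left cross_mult_right divide_inverse mult_ac)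
  then show "acc t \<bullet> N t = (\<sigma> t)\<^sup>2 * \<kappa> t"
    unfolding curvature_def using speed_pos[OF assms] V_nz[OF assms]
    by (simp add: field_simps power2_eq_square power3_eq_cube)
  show "acc t \<bullet> B t = 0"
    unfolding binormal_def V_eq by (simp add: dot_cross_self)
qed

text \<open>The derivative of a unit vector is orthogonal to it, so only two coordinates remain. They are
  read off from \<open>\<gamma>'' = \<sigma>' T + \<sigma> T'\<close>, in which the first term is tangential.\<close>

lemma frenet_tangent:
  assumes "t \<in> I"
  shows "deriv_within I T t = (\<sigma> t * \<kappa> t) *\<^sub>R N t"
proof -
  let ?T' = "deriv_within I T t"
  have "?T' \<bullet> T t = 0"
    using inner_deriv_within_eq_0[OF interval smooth_frame(1,1) assms frame_tangent_binormal(1)]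
    by (simp add: inner_commute)
  moreover have "acc t = \<sigma> t *\<^sub>R ?T' + deriv_within I \<sigma> t *\<^sub>R T t"
    using deriv_within_cong[OF interval, of "\<lambda>s. \<sigma> s *\<^sub>R T s" vel t] vel_eq assms
      deriv_within_scaleR[OF interval smooth_speed smooth_frame(1) assms]
      smooth_on_differentiable_on[OF smooth_on_scaleR[OF interval smooth_speed smooth_frame(1)]]
    by simp
  then have "acc t \<bullet> N t = \<sigma> t * (?T' \<bullet> N t)" "acc t \<bullet> B t = \<sigma> t * (?T' \<bullet> B t)"
    using frame_normal[OF assms] frame_tangent_binormal[OF assms]
    by (simp_all add: inner_add_left inner_add_right inner_commute)
  then have "?T' \<bullet> N t = \<sigma> t * \<kappa> t" "?T' \<bullet> B t = 0"
    using acc_normal_binormal[OF assms] speed_pos[OF assms] by (simp_all add: power2_eq_square)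
  ultimately show ?thesis
    using frame_expansion[OF assms, of ?T'] by simp
qed

text \<open>Again two coordinates vanish: \<open>B\<close> is a unit vector, and \<open>B \<bullet> T = 0\<close> with \<open>T'\<close> parallel to \<open>N\<close>.
  The third comes from \<open>(\<gamma>' \<times> \<gamma>'')' = \<gamma>' \<times> (\<gamma>'')'\<close>, whose normal component is a multiple of the
  determinant in the definition of the torsion.\<close>

lemma frenet_binormal:
  assumes "t \<in> I"
  shows "deriv_within I B t = - (\<sigma> t * \<tau> t) *\<^sub>R N t"
proof -
  let ?B' = "deriv_within I B t" and ?j = "deriv_within I acc t"
  have 1: "?B' \<bullet> B t = 0"
    using inner_deriv_within_eq_0[OF interval smooth_frame(3,3) assms frame_tangent_binormal(2)]
    by (simp add: inner_commute)
  have 2: "?B' \<bullet> T t = 0"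
    using inner_deriv_within_eq_0[OF interval smooth_frame(1,3) assms frame_tangent_binormal(3)]
      frame_normal[OF assms] frenet_tangent[OF assms]
    by (simp add: inner_commute)
  have "deriv_within I V t = cross3 (vel t) ?j"
    using deriv_within_cross3[OF interval smooth_curve(2,3) assms]
    by (simp add: V_eq[abs_def])
  moreover have V': "deriv_within I V t
      = norm (V t) *\<^sub>R ?B' + deriv_within I (\<lambda>s. norm (V s)) t *\<^sub>R B t"
    using deriv_within_cong[OF interval, of "\<lambda>s. norm (V s) *\<^sub>R B s" V t] V_eq_binormal assms
      deriv_within_scaleR[OF interval smooth_norm_V smooth_frame(3) assms]
      smooth_on_differentiable_on[OF smooth_on_scaleR[OF interval smooth_norm_V smooth_frame(3)]]
    by simp
  have "deriv_within I V t \<bullet> N t = norm (V t) * (?B' \<bullet> N t)"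
    unfolding V' using frame_normal[OF assms] by (simp add: inner_add_left inner_add_right inner_commute)
  ultimately have "cross3 (vel t) ?j \<bullet> N t = norm (V t) * (?B' \<bullet> N t)"
    by simp
  moreover have "cross3 (vel t) ?j \<bullet> N t = - (\<sigma> t) * (V t \<bullet> ?j) / norm (V t)"
  proof -
    have "cross3 (vel t) ?j \<bullet> cross3 (V t) (vel t)
        = (vel t \<bullet> V t) * (?j \<bullet> vel t) - (vel t \<bullet> vel t) * (?j \<bullet> V t)"
      by (rule dot_cross)
    also have "\<dots> = - ((\<sigma> t)\<^sup>2 * (V t \<bullet> ?j))"
      unfolding speed_def power2_norm_eq_inner by (simp add: V_eq dot_cross_self inner_commute)
    finally show ?thesis
      unfolding principal_normal_def tangent_def binormal_def
      using speed_pos[OF assms] V_nz[OF assms]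
      by (simp add: cross_mult_left cross_mult_right field_simps power2_eq_square)
  qed
  ultimately have "?B' \<bullet> N t = - (\<sigma> t * \<tau> t)"
    unfolding torsion_eq using V_nz[OF assms]
    by (simp add: field_simps power2_eq_square)
  then show ?thesis
    using frame_expansion[OF assms, of ?B'] 1 2 by simp
qed

lemma frenet_normal:
  assumes "t \<in> I"
  shows "deriv_within I N t = - (\<sigma> t * \<kappa> t) *\<^sub>R T t + (\<sigma> t * \<tau> t) *\<^sub>R B t"
proof -
  have "deriv_within I N t
      = cross3 (B t) (deriv_within I T t) + cross3 (deriv_within I B t) (T t)"
    using deriv_within_cross3[OF interval smooth_frame(3,1) assms]
    by (simp add: principal_normal_def[abs_def])
  then show ?thesis
    using frenet_tangent[OF assms] frenet_binormal[OF assms] frame_normal(4,5)[OF assms]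
      cross_skew[of "B t" "N t"] cross_skew[of "N t" "T t"]
    by (simp add: cross_mult_left cross_mult_right)
qed

lemma deriv_within_reciprocal_curvature:
  assumes "t \<in> I" "\<And>s. s \<in> I \<Longrightarrow> l s = 1 / \<kappa> s"
  shows "deriv_within I l t = - deriv_within I \<kappa> t / (\<kappa> t)\<^sup>2"
proof (rule deriv_within_eqI[OF interval assms(1)])
  have "((\<lambda>s. 1 / \<kappa> s) has_real_derivative - deriv_within I \<kappa> t / (\<kappa> t)\<^sup>2) (at t within I)"
    using smooth_on_has_vector_derivative[OF smooth_curvature assms(1)] curvature_pos[OF assms(1)]
    unfolding has_real_derivative_iff_has_vector_derivative[symmetric]
    by (auto intro!: derivative_eq_intros simp: power2_eq_square)
  then show "(l has_vector_derivative - deriv_within I \<kappa> t / (\<kappa> t)\<^sup>2) (at t within I)"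
    unfolding has_real_derivative_iff_has_vector_derivative
    by (rule has_vector_derivative_transform[OF assms(1), rotated]) (simp add: assms(2))
qed

section \<open>Curves displaced in the normal plane\<close>

lemma deriv_within_displaced_curve:
  assumes "smooth_on I l" "smooth_on I e" "t \<in> I"
    and \<delta>: "\<And>s. s \<in> I \<Longrightarrow> \<delta> s = \<gamma> s + l s *\<^sub>R N s + e s *\<^sub>R B s"
  shows "deriv_within I \<delta> t =
    (\<sigma> t * (1 - l t * \<kappa> t)) *\<^sub>R T t
    + (deriv_within I l t - e t * \<sigma> t * \<tau> t) *\<^sub>R N t
    + (deriv_within I e t + l t * \<sigma> t * \<tau> t) *\<^sub>R B t"
proof -
  note smooth = smooth_on_scaleR[OF interval assms(1) smooth_frame(2)]
    smooth_on_scaleR[OF interval assms(2) smooth_frame(3)]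
  note smooth_add = smooth_on_add[OF interval smooth_curve(1) smooth(1)]
  have "deriv_within I \<delta> t = deriv_within I (\<lambda>s. \<gamma> s + l s *\<^sub>R N s + e s *\<^sub>R B s) t"
    by (rule deriv_within_cong[OF interval
        smooth_on_differentiable_on[OF smooth_on_add[OF interval smooth_add smooth(2)]] _ assms(3)])
       (simp add: \<delta>)
  also have "\<dots> = \<sigma> t *\<^sub>R T t + (l t *\<^sub>R deriv_within I N t + deriv_within I l t *\<^sub>R N t)
      + (e t *\<^sub>R deriv_within I B t + deriv_within I e t *\<^sub>R B t)"
    using deriv_within_add[OF interval smooth_add smooth(2) assms(3)]
      deriv_within_add[OF interval smooth_curve(1) smooth(1) assms(3)]
      deriv_within_scaleR[OF interval assms(1) smooth_frame(2) assms(3)]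
      deriv_within_scaleR[OF interval assms(2) smooth_frame(3) assms(3)]
      vel_eq[OF assms(3)]
    by simp
  finally show ?thesis
    unfolding frenet_normal[OF assms(3)] frenet_binormal[OF assms(3)]
    by (simp add: algebra_simps)
qed

text \<open>The tangential part of the acceleration \<open>u' B + u B'\<close> vanishes, so the osculating plane is
  the normal plane of \<open>\<gamma>\<close>. It degenerates exactly where the binormal stands still, that is, where
  \<open>\<tau> = 0\<close>, or where \<open>u\<close> vanishes.\<close>

lemma cross_along_binormal:
  assumes "smooth_on I u" "t \<in> I" "\<And>s. s \<in> I \<Longrightarrow> deriv_within I \<delta> s = u s *\<^sub>R B s"
  shows "velocity_cross_acceleration I \<delta> t = ((u t)\<^sup>2 * \<sigma> t * \<tau> t) *\<^sub>R T t"
proof -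
  have "deriv_within I (deriv_within I \<delta>) t = deriv_within I (\<lambda>s. u s *\<^sub>R B s) t"
    by (rule deriv_within_cong[OF interval smooth_on_differentiable_on[OF
          smooth_on_scaleR[OF interval assms(1) smooth_frame(3)]] _ assms(2)])
       (simp add: assms(3))
  then have "deriv_within I (deriv_within I \<delta>) t
      = - (u t * \<sigma> t * \<tau> t) *\<^sub>R N t + deriv_within I u t *\<^sub>R B t"
    using deriv_within_scaleR[OF interval assms(1) smooth_frame(3) assms(2)]
      frenet_binormal[OF assms(2)] by simp
  then show ?thesis
    using assms(2,3) frame_normal(5)[OF assms(2)] cross_skew[of "B t" "N t"]
    unfolding velocity_cross_acceleration_def
    by (simp add: numeral_2_eq_2 cross_mult_left cross_mult_right Cross3.right_diff_distrib
        power2_eq_square mult_ac)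
qed

text \<open>Velocity and acceleration of the mate are orthogonal to its binormal \<open>\<plusminus>T\<close>. The velocity gives
  \<open>1 - l \<kappa> = 0\<close>. Differentiating \<open>\<delta>' \<bullet> T = 0\<close> then gives \<open>\<delta>' \<bullet> T' = 0\<close>, so \<open>\<delta>'\<close> has no normal
  component either.\<close>

lemma normal_binormal_mateE:
  assumes "mates I Normal Binormal Binormal \<gamma> \<delta>"
  obtains l e where "smooth_on I (\<lambda>t. (l t, e t))" "nowhere_identically_zero I (\<lambda>t. (l t, e t))"
    and "\<And>t. t \<in> I \<Longrightarrow> l t = 1 / \<kappa> t"
    and "\<And>t. t \<in> I \<Longrightarrow> deriv_within I l t = e t * \<sigma> t * \<tau> t"
    and "\<And>t. t \<in> I \<Longrightarrow> deriv_within I \<delta> t = (deriv_within I e t + l t * \<sigma> t * \<tau> t) *\<^sub>R B t"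
    and "smooth_on I e" "smooth_on I l"
proof -
  interpret \<delta>: nondegenerate_space_curve I \<delta>
    using assms interval unfolding mates_def by unfold_locales auto
  obtain l e where smooth: "smooth_on I (\<lambda>t. (l t, e t))"
    and nz: "nowhere_identically_zero I (\<lambda>t. (l t, e t))"
    and \<delta>: "\<And>t. t \<in> I \<Longrightarrow> \<delta> t = \<gamma> t + l t *\<^sub>R N t + e t *\<^sub>R B t"
    and cross: "\<And>t. t \<in> I \<Longrightarrow> cross3 (N t) (B t) = binormal I \<delta> t
        \<or> cross3 (N t) (B t) = - binormal I \<delta> t"
    using assms unfolding mates_def by auto
  have le: "smooth_on I l" "smooth_on I e"
    using bounded_linear.smooth_on[OF bounded_linear_fst interval smooth]
      bounded_linear.smooth_on[OF bounded_linear_snd interval smooth] by simp_all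
  have vel: "deriv_within I \<delta> t =
      (\<sigma> t * (1 - l t * \<kappa> t)) *\<^sub>R T t
      + (deriv_within I l t - e t * \<sigma> t * \<tau> t) *\<^sub>R N t
      + (deriv_within I e t + l t * \<sigma> t * \<tau> t) *\<^sub>R B t" if "t \<in> I" for t
    by (rule deriv_within_displaced_curve[OF le that]) (rule \<delta>)
  have T: "T t = binormal I \<delta> t \<or> T t = - binormal I \<delta> t" if "t \<in> I" for t
    using cross[OF that] frame_normal(5)[OF that] by simp
  have "deriv_within I \<delta> t \<bullet> binormal I \<delta> t = 0" for t
    unfolding binormal_def \<delta>.V_eq by (simp add: dot_cross_self)
  then have vel_T: "deriv_within I \<delta> t \<bullet> T t = 0" if "t \<in> I" for t
    using T[OF that] by (metis inner_minus_right neg_equal_0_iff_equal)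
  have acc_T: "deriv_within I (deriv_within I \<delta>) t \<bullet> T t = 0" if "t \<in> I" for t
    using T[OF that] \<delta>.acc_normal_binormal(2)[OF that]
    by (metis inner_minus_right neg_equal_0_iff_equal)
  have l: "l t = 1 / \<kappa> t" if "t \<in> I" for t
  proof -
    have "\<sigma> t * (1 - l t * \<kappa> t) = 0"
      using vel_T[OF that] frame_tangent_binormal[OF that] frame_normal[OF that]
      unfolding vel[OF that] by (simp add: inner_add_left inner_add_right inner_commute)
    then show ?thesis
      using speed_pos[OF that] curvature_pos[OF that] by (simp add: field_simps)
  qed
  have l': "deriv_within I l t = e t * \<sigma> t * \<tau> t" if "t \<in> I" for t
  proof -
    have "deriv_within I \<delta> t \<bullet> ((\<sigma> t * \<kappa> t) *\<^sub>R N t) = 0"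
      using inner_deriv_within_eq_0[OF interval \<delta>.smooth_curve(2) smooth_frame(1) that vel_T]
        acc_T[OF that] frenet_tangent[OF that] by simp
    then have "deriv_within I \<delta> t \<bullet> N t = 0"
      using speed_pos[OF that] curvature_pos[OF that] by simp
    then show ?thesis
      using frame_tangent_binormal[OF that] frame_normal[OF that]
      unfolding vel[OF that] by (simp add: inner_add_left inner_add_right inner_commute)
  qed
  have "deriv_within I \<delta> t = (deriv_within I e t + l t * \<sigma> t * \<tau> t) *\<^sub>R B t" if "t \<in> I" for t
    using vel[OF that] l[OF that] l'[OF that] curvature_pos[OF that] by simp
  with smooth nz l l' le show ?thesis
    using that by blast
qed

lemma torsion_nonzero_of_mate:
  assumes "mates I Normal Binormal Binormal \<gamma> \<delta>" "t \<in> I"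
  shows "\<tau> t \<noteq> 0"
proof
  assume "\<tau> t = 0"
  obtain l e where le: "smooth_on I l" "smooth_on I e"
    and vel: "\<And>t. t \<in> I \<Longrightarrow> deriv_within I \<delta> t = (deriv_within I e t + l t * \<sigma> t * \<tau> t) *\<^sub>R B t"
    using normal_binormal_mateE[OF assms(1)] by metis
  have "smooth_on I (\<lambda>t. deriv_within I e t + l t * \<sigma> t * \<tau> t)"
    by (intro smooth_on_add smooth_on_mult smooth_on_deriv_within interval le
        smooth_speed smooth_torsion)
  from cross_along_binormal[OF this assms(2) vel] \<open>\<tau> t = 0\<close>
  have "velocity_cross_acceleration I \<delta> t = 0"
    by simp
  then show False
    using assms unfolding mates_def nondegenerate_curve_def by blast
qed

text \<open>With \<open>l = 1 / \<kappa>\<close> and \<open>l' = e \<sigma> \<tau>\<close> the displaced curve moves along \<open>B\<close> with signed speed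
  \<open>u = e' + l \<sigma> \<tau>\<close>. Where neither \<open>u\<close> nor \<open>\<tau>\<close> vanishes, its binormal is \<open>T\<close> up to the sign of \<open>\<tau>\<close>.\<close>

lemma bertrand_type_of_displacement:
  assumes smooth: "smooth_on I (\<lambda>t. (l t, e t))"
    and nz: "nowhere_identically_zero I (\<lambda>t. (l t, e t))"
    and l: "\<And>t. t \<in> I \<Longrightarrow> l t = 1 / \<kappa> t"
    and l': "\<And>t. t \<in> I \<Longrightarrow> deriv_within I l t = e t * \<sigma> t * \<tau> t"
    and u_nz: "\<And>t. t \<in> I \<Longrightarrow> deriv_within I e t + l t * \<sigma> t * \<tau> t \<noteq> 0"
    and \<tau>: "\<And>t. t \<in> I \<Longrightarrow> \<tau> t \<noteq> 0"
  shows "bertrand_type I Normal Binormal Binormal \<gamma>"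
proof -
  define \<delta> where "\<delta> t = \<gamma> t + l t *\<^sub>R N t + e t *\<^sub>R B t" for t
  define u where "u t = deriv_within I e t + l t * \<sigma> t * \<tau> t" for t
  have le: "smooth_on I l" "smooth_on I e"
    using bounded_linear.smooth_on[OF bounded_linear_fst interval smooth]
      bounded_linear.smooth_on[OF bounded_linear_snd interval smooth] by simp_all
  have smooth_u: "smooth_on I u"
    unfolding u_def[abs_def]
    by (intro smooth_on_add smooth_on_mult smooth_on_deriv_within interval le
        smooth_speed smooth_torsion)
  have smooth_\<delta>: "smooth_on I \<delta>"
    unfolding \<delta>_def[abs_def]
    by (intro smooth_on_add smooth_on_scaleR interval le smooth_curve smooth_frame)
  have vel: "deriv_within I \<delta> t = u t *\<^sub>R B t" if "t \<in> I" for t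
    using deriv_within_displaced_curve[OF le that \<delta>_def] l[OF that] l'[OF that]
      curvature_pos[OF that]
    by (simp add: u_def)
  have cross: "velocity_cross_acceleration I \<delta> t = ((u t)\<^sup>2 * \<sigma> t * \<tau> t) *\<^sub>R T t" if "t \<in> I" for t
    using cross_along_binormal[OF smooth_u that vel] .
  have frame_nz: "T t \<noteq> 0" "B t \<noteq> 0" if "t \<in> I" for t
    using frame_tangent_binormal[OF that] by auto
  have factor_nz: "u t \<noteq> 0" "(u t)\<^sup>2 * \<sigma> t * \<tau> t \<noteq> 0" if "t \<in> I" for t
    using u_nz[OF that] \<tau>[OF that] speed_pos[OF that] by (simp_all add: u_def)
  have nondegenerate_\<delta>: "nondegenerate_curve I \<delta>"
    unfolding nondegenerate_curve_def
    using smooth_\<delta> vel cross frame_nz factor_nz by simp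
  have binormal: "T t = binormal I \<delta> t \<or> T t = - binormal I \<delta> t" if "t \<in> I" for t
  proof -
    define c where "c = (u t)\<^sup>2 * \<sigma> t * \<tau> t"
    have "norm (T t) = 1"
      using frame_tangent_binormal(1)[OF that] by (simp add: norm_eq_1)
    moreover have "c \<noteq> 0"
      using factor_nz(2)[OF that] unfolding c_def .
    ultimately show ?thesis
      unfolding binormal_def cross[OF that] c_def[symmetric] by (simp add: abs_if)
  qed
  have "mates I Normal Binormal Binormal \<gamma> \<delta>"
    unfolding mates_def
    by (rule conjI[OF nondegenerate conjI[OF nondegenerate_\<delta>]], rule exI[of _ l], rule exI[of _ e])
       (use smooth nz frame_normal(5) binormal in \<open>auto simp: \<delta>_def\<close>)
  moreover have "\<exists>t\<in>I. \<delta> t \<noteq> \<gamma> t"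
  proof -
    obtain t where t: "t \<in> I"
      using interval unfolding nontrivial_interval_def by blast
    have "(\<delta> t - \<gamma> t) \<bullet> N t = l t"
      using frame_normal[OF t] by (simp add: \<delta>_def inner_add_left inner_add_right inner_commute)
    then show ?thesis
      using l[OF t] curvature_pos[OF t] t by force
  qed
  ultimately show ?thesis
    unfolding bertrand_type_def using nondegenerate_\<delta> by blast
qed

end

section \<open>The characterization of Bertrand type curves\<close>

theorem theorem3p3:
  fixes I :: "real set" and \<gamma> :: "real \<Rightarrow> real^3"
  assumes "nontrivial_interval I"
    and "nondegenerate_curve I \<gamma>"
  shows
    "((\<forall>t\<in>I. torsion I \<gamma> t \<noteq> 0) \<and>
      (\<exists>h :: real \<Rightarrow> real. smooth_on I h \<and>
        (\<forall>t\<in>I. h t = speed I \<gamma> t * torsion I \<gamma> t / curvature I \<gamma> t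
                 - deriv_within I (\<lambda>s. deriv_within I (curvature I \<gamma>) s / (curvature I \<gamma> s)\<^sup>2
                                       * (1 / (speed I \<gamma> s * torsion I \<gamma> s))) t
               \<and> h t \<noteq> 0))
      \<longrightarrow> (bertrand_type I Normal Binormal Binormal \<gamma> \<longleftrightarrow>
           (\<exists>l e :: real \<Rightarrow> real.
              smooth_on I (\<lambda>t. (l t, e t)) \<and> nowhere_identically_zero I (\<lambda>t. (l t, e t)) \<and>
              (\<forall>t\<in>I. l t = 1 / curvature I \<gamma> t \<and>
                 e t = - deriv_within I (curvature I \<gamma>) t
                       / (speed I \<gamma> t * (curvature I \<gamma> t)\<^sup>2 * torsion I \<gamma> t)))))
     \<and> ((\<exists>t\<in>I. torsion I \<gamma> t = 0) \<longrightarrow> \<not> bertrand_type I Normal Binormal Binormal \<gamma>)"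
proof -
  interpret nondegenerate_space_curve I \<gamma>
    using assms by unfold_locales
  let ?g = "\<lambda>s. deriv_within I \<kappa> s / (\<kappa> s)\<^sup>2 * (1 / (\<sigma> s * \<tau> s))"
  let ?D = "\<lambda>l e. smooth_on I (\<lambda>t. (l t, e t)) \<and> nowhere_identically_zero I (\<lambda>t. (l t, e t)) \<and>
    (\<forall>t\<in>I. l t = 1 / \<kappa> t \<and> e t = - deriv_within I \<kappa> t / (\<sigma> t * (\<kappa> t)\<^sup>2 * \<tau> t))"
  have "bertrand_type I Normal Binormal Binormal \<gamma> \<longleftrightarrow> (\<exists>l e. ?D l e)"
    if \<tau>: "\<And>t. t \<in> I \<Longrightarrow> \<tau> t \<noteq> 0"
      and h: "\<And>t. t \<in> I \<Longrightarrow> \<sigma> t * \<tau> t / \<kappa> t - deriv_within I ?g t \<noteq> 0"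
  proof
    assume "bertrand_type I Normal Binormal Binormal \<gamma>"
    then obtain \<delta> where mates: "mates I Normal Binormal Binormal \<gamma> \<delta>"
      unfolding bertrand_type_def by blast
    obtain l e where le: "smooth_on I (\<lambda>t. (l t, e t))"
        "nowhere_identically_zero I (\<lambda>t. (l t, e t))"
      and l: "\<And>t. t \<in> I \<Longrightarrow> l t = 1 / \<kappa> t"
      and l': "\<And>t. t \<in> I \<Longrightarrow> deriv_within I l t = e t * \<sigma> t * \<tau> t"
      by (rule normal_binormal_mateE[OF mates]) (rule that)
    have "e t = - deriv_within I \<kappa> t / (\<sigma> t * (\<kappa> t)\<^sup>2 * \<tau> t)" if "t \<in> I" for t
      using l'[OF that] deriv_within_reciprocal_curvature[OF that l] \<tau>[OF that]
        speed_pos[OF that] curvature_pos[OF that]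
      by (simp add: field_simps)
    then have "?D l e"
      using le l by blast
    then show "\<exists>l e. ?D l e"
      by blast
  next
    assume "\<exists>l e. ?D l e"
    then obtain l e where le: "smooth_on I (\<lambda>t. (l t, e t))"
        "nowhere_identically_zero I (\<lambda>t. (l t, e t))"
      and l: "\<And>t. t \<in> I \<Longrightarrow> l t = 1 / \<kappa> t"
      and e: "\<And>t. t \<in> I \<Longrightarrow> e t = - deriv_within I \<kappa> t / (\<sigma> t * (\<kappa> t)\<^sup>2 * \<tau> t)"
      by blast
    have smooth_e: "smooth_on I e"
      using bounded_linear.smooth_on[OF bounded_linear_snd interval le(1)] by simp
    show "bertrand_type I Normal Binormal Binormal \<gamma>"
    proof (rule bertrand_type_of_displacement[OF le l _ _ \<tau>])
      fix t assume t: "t \<in> I"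
      show "deriv_within I l t = e t * \<sigma> t * \<tau> t"
        using deriv_within_reciprocal_curvature[OF t l] e[OF t] \<tau>[OF t] speed_pos[OF t]
        by (simp add: field_simps)
      \<comment> \<open>The function differentiated in \<open>h\<close> is \<open>- e\<close>, whence \<open>h = e' + l \<sigma> \<tau>\<close>.\<close>
      have "(?g has_vector_derivative - deriv_within I e t) (at t within I)"
        by (rule has_vector_derivative_transform[OF t _
              has_vector_derivative_minus[OF smooth_on_has_vector_derivative[OF smooth_e t]]])
           (simp add: e mult_ac)
      then have "deriv_within I ?g t = - deriv_within I e t"
        by (rule deriv_within_eqI[OF interval t])
      then show "deriv_within I e t + l t * \<sigma> t * \<tau> t \<noteq> 0"
        using h[OF t] l[OF t] by (simp add: add.commute)
    qed
  qed
  moreover have "\<not> bertrand_type I Normal Binormal Binormal \<gamma>" if "\<exists>t\<in>I. \<tau> t = 0"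
    using that torsion_nonzero_of_mate unfolding bertrand_type_def by blast
  ultimately show ?thesis
    by (smt (verit))
qed

end
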